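(* Let $x_1,y_1,u_2,v_2 \in (\mathbf{R}/\mathbf{Z})\setminus\{0\}$ with $x_1+y_1\neq 0$ and $u_2-v_2\neq0$. Then \[ G^{(1)}_{x_1+y_1,u_2} G^{(2)}_{y_1,v_2-u_2} + G^{(1)}_{y_1,v_2} G^{(2)}_{x_1,u_2} - G^{(1)}_{x_1+y_1,v_2} G^{(2)}_{x_1,u_2-v_2} - G^{(1)}_{y_1,v_2-u_2} G^{(2)}_{x_1+y_1,u_2} = 0. \]
   Context: Write $e(z)=e^{2\pi i z}$ and $q^\alpha = e(\alpha\tau)$ for $\tau$ in the upper half-plane, $\alpha\in\mathbf{R}$. For $t\in\mathbf{R}$, $\{t\}$ is the fractional part and $B_k$ the $k$-th Bernoulli polynomial ($B_1(t)=t-\frac12$). For an integer $k\ge1$ and $\mathbf{x}=(x_1,x_2)\in(\mathbf{R}/\mathbf{Z})^2$ define \[ G^{(k)}_{\mathbf x}(\tau)=a_0(G^{(k)}_{\mathbf x})+\sum_{\substack{m,n\in\mathbf{R}_{>0}\\ (m,n)\equiv \mathbf{x} \bmod 1}} m^{k-1}q^{mn}+(-1)^k\sum_{\substack{m,n\in\mathbf{R}_{>0}\\ (m,n)\equiv -\mathbf{x} \bmod 1}} m^{k-1}q^{mn}, \] where $a_0(G^{(1)}_{\mathbf x})=-B_1(\{x_2\})$ if $x_1=0\neq x_2$, $=-B_1(\{x_1\})$ if $x_1\ne0=x_2$, and $=0$ otherwise; and for $k\ge2$, $a_0(G^{(k)}_{\mathbf x})=-B_k(\{x_1\})/k$ if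 $x_2=0$ and $0$ if $x_2\neq0$. *)

theory Defs
  imports "HOL-Analysis.Analysis" "HOL-Library.Real_Mod"
begin

fun bernoulli_number :: "nat \<Rightarrow> real" where
  "bernoulli_number n =
     (if n = 0 then 1
      else - (\<Sum>k<n. real (Suc n choose k) * bernoulli_number k) / real (Suc n))"

declare bernoulli_number.simps [simp del]

definition bernoulli_poly :: "nat \<Rightarrow> real \<Rightarrow> real" where
  "bernoulli_poly n t = (\<Sum>k\<le>n. real (n choose k) * bernoulli_number k * t ^ (n - k))"

text \<open>The recurrence gives the convention in which the first Bernoulli number is minus one half.\<close>

lemma bernoulli_poly_1: "bernoulli_poly 1 t = t - 1 / 2"
  by (simp add: bernoulli_poly_def bernoulli_number.simps)

lemma bernoulli_poly_2: "bernoulli_poly 2 t = t ^ 2 - t + 1 / 6"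
  by (simp add: bernoulli_poly_def bernoulli_number.simps numeral_2_eq_2 lessThan_Suc)

text \<open>\<open>q_powr \<alpha> \<tau>\<close> is \<open>q\<close> to the real power \<open>\<alpha>\<close>, normalised as \<open>e(\<alpha> \<tau>)\<close>;
  no branch of a complex logarithm is involved.\<close>

definition e :: "complex \<Rightarrow> complex" where
  "e z = exp (2 * of_real pi * \<i> * z)"

definition q_powr :: "real \<Rightarrow> complex \<Rightarrow> complex" where
  "q_powr \<alpha> \<tau> = e (of_real \<alpha> * \<tau>)"

text \<open>Elements of \<open>\<real>/\<int>\<close> are given by real representatives throughout: the zero class is
  \<open>\<int>\<close>, and \<open>G_cong\<close> below shows that \<open>G\<close> depends only on the two classes.\<close>

definition eis_sum :: "nat \<Rightarrow> real \<Rightarrow> real \<Rightarrow> complex \<Rightarrow> complex" where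
  "eis_sum k x1 x2 \<tau> =
     (\<Sum>\<^sub>\<infinity>(m, n) \<in> {(m, n). m > 0 \<and> n > 0 \<and> [m = x1] (rmod 1) \<and> [n = x2] (rmod 1)}.
        of_real m ^ (k - 1) * q_powr (m * n) \<tau>)"

definition a0 :: "nat \<Rightarrow> real \<Rightarrow> real \<Rightarrow> real" where
  "a0 k x1 x2 =
     (if k = 1 then
        (if x1 \<in> \<int> \<and> x2 \<notin> \<int> then - bernoulli_poly 1 (frac x2)
         else if x1 \<notin> \<int> \<and> x2 \<in> \<int> then - bernoulli_poly 1 (frac x1)
         else 0)
      else
        (if x2 \<in> \<int> then - bernoulli_poly k (frac x1) / real k else 0))"

text \<open>Meaningful for \<open>k \<ge> 1\<close> and \<open>Im \<tau> > 0\<close>, where both sums converge absolutely; the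
  default value 0 of \<open>infsum\<close> for non-summable families thus plays no role.\<close>

definition G :: "nat \<Rightarrow> real \<Rightarrow> real \<Rightarrow> complex \<Rightarrow> complex" where
  "G k x1 x2 \<tau> =
     of_real (a0 k x1 x2) + eis_sum k x1 x2 \<tau> + (- 1) ^ k * eis_sum k (- x1) (- x2) \<tau>"

lemma G_cong:
  assumes "x1 - x1' \<in> \<int>" "x2 - x2' \<in> \<int>"
  shows "G k x1 x2 = G k x1' x2'"
proof -
  have rep: "\<exists>j. x = x' + of_int j" if "x - x' \<in> \<int>" for x x' :: real
    using that by (metis Ints_cases add.commute diff_add_cancel)
  have fr: "frac x = frac x'" and int: "x \<in> \<int> \<longleftrightarrow> x' \<in> \<int>"
    if xx: "x - x' \<in> \<int>" for x x' :: real
  proof -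
    from rep[OF xx] obtain j where j: "x = x' + of_int j" by blast
    show "frac x = frac x'" using j by (simp add: frac_def)
    then show "x \<in> \<int> \<longleftrightarrow> x' \<in> \<int>" by (metis frac_eq_0_iff)
  qed
  have rc: "[m = x] (rmod 1) \<longleftrightarrow> [m = x'] (rmod 1)" if xx: "x - x' \<in> \<int>" for m x x' :: real
  proof -
    from rep[OF xx] obtain j where "x = x' + of_int j" by blast
    then have "[x = x'] (rmod 1)"
      by (auto simp: rcong_altdef algebra_simps intro!: exI[of _ "-j"])
    then show ?thesis by (meson rcong_sym rcong_trans)
  qed
  have "- x1 - - x1' \<in> \<int>" "- x2 - - x2' \<in> \<int>"
    using assms by (metis Ints_minus minus_diff_minus)+
  note rcs = rc[OF this(1)] rc[OF this(2)] rc[OF assms(1)] rc[OF assms(2)]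
  show ?thesis
    by (rule ext, unfold G_def eis_sum_def a0_def rcs fr[OF assms(1)] fr[OF assms(2)]
      int[OF assms(1)] int[OF assms(2)]) (rule refl)
qed

end

theory Submission
  imports Defs
begin

text \<open>For \<open>x\<close>, \<open>u\<close> not integral and \<open>0 < u < 1\<close>, summing the geometric series over the second
  index turns \<open>G\<^sup>(\<^sup>k\<^sup>)\<close> into the absolutely convergent bilateral series
  \<open>\<Sum> m\<^sup>k\<^sup>-\<^sup>1 q\<^sup>m\<^sup>u / (1 - q\<^sup>m)\<close> over all \<open>m \<in> x + \<int>\<close>; here the constant terms vanish.
  Each product in the theorem becomes a double series over \<open>(m, n) \<in> (x1 + \<int>) \<times> (y1 + \<int>)\<close>, with
  \<open>l = m + n\<close> running through \<open>x1 + y1 + \<int>\<close>. Since \<open>l - n = m\<close>, the claim then holds term by term: it is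
  \<open>m\<close> times the partial fraction identity for \<open>1 / ((1 - A) (1 - B))\<close> with \<open>A = q\<^sup>m\<close>, \<open>B = q\<^sup>n\<close>.\<close>

text \<open>A Fubini argument: the rows sum to \<open>f a * T\<close>, and absolute convergence of
  both factors makes the product family absolutely summable, so iterated and double sums
  agree.\<close>

lemma has_sum_mult_Times:
  fixes f :: "'a \<Rightarrow> complex" and g :: "'b \<Rightarrow> complex"
  assumes f: "(f has_sum S) A" "(\<lambda>a. norm (f a)) summable_on A"
    and g: "(g has_sum T) B" "(\<lambda>b. norm (g b)) summable_on B"
  shows "((\<lambda>(a, b). f a * g b) has_sum S * T) (A \<times> B)"
proof (rule has_sum_SigmaI)
  show "((\<lambda>b. case (a, b) of (a, b) \<Rightarrow> f a * g b) has_sum f a * T) B" for a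
    using has_sum_cmult_right[OF g(1), of "f a"] by simp
  show "((\<lambda>a. f a * T) has_sum S * T) A"
    by (rule has_sum_cmult_left[OF f(1)])
  have "(\<lambda>ab. norm (case ab of (a, b) \<Rightarrow> f a * g b)) summable_on A \<times> B"
  proof (rule summable_on_SigmaI)
    show "((\<lambda>b. norm (case (a, b) of (a, b) \<Rightarrow> f a * g b)) has_sum
        norm (f a) * (\<Sum>\<^sub>\<infinity>b\<in>B. norm (g b))) B" for a
      using has_sum_cmult_right[OF has_sum_infsum[OF g(2)], of "norm (f a)"]
      by (simp add: norm_mult)
    show "(\<lambda>a. norm (f a) * (\<Sum>\<^sub>\<infinity>b\<in>B. norm (g b))) summable_on A"
      by (rule summable_on_cmult_left[OF f(2)])
  qed auto
  then show "(\<lambda>(a, b). f a * g b) summable_on A \<times> B"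
    by (rule abs_summable_summable)
qed

section \<open>Real powers of q\<close>

lemma q_powr_0 [simp]: "q_powr 0 \<tau> = 1"
  by (simp add: q_powr_def e_def)

lemma q_powr_add: "q_powr (a + b) \<tau> = q_powr a \<tau> * q_powr b \<tau>"
  by (simp add: q_powr_def e_def algebra_simps flip: exp_add)

lemma q_powr_nonzero [simp]: "q_powr a \<tau> \<noteq> 0"
  by (simp add: q_powr_def e_def)

lemma q_powr_minus: "q_powr (- a) \<tau> = inverse (q_powr a \<tau>)"
  by (simp add: q_powr_def e_def exp_minus)

lemma q_powr_diff: "q_powr (a - b) \<tau> = q_powr a \<tau> / q_powr b \<tau>"
  using q_powr_add[of a "- b" \<tau>] by (simp add: q_powr_minus field_simps)

lemma q_powr_mult_nat: "q_powr (a * real j) \<tau> = q_powr a \<tau> ^ j"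
  by (induction j) (simp_all add: q_powr_add algebra_simps)

lemma norm_q_powr: "norm (q_powr a \<tau>) = exp (- (2 * pi * Im \<tau>) * a)"
  by (simp add: q_powr_def e_def)

lemma norm_q_powr_less_1: "Im \<tau> > 0 \<Longrightarrow> a > 0 \<Longrightarrow> norm (q_powr a \<tau>) < 1"
  by (simp add: norm_q_powr)

lemma norm_q_powr_antimono: "Im \<tau> > 0 \<Longrightarrow> a \<le> b \<Longrightarrow> norm (q_powr b \<tau>) \<le> norm (q_powr a \<tau>)"
  by (simp add: norm_q_powr mult_left_mono)

lemma q_powr_neq_1:
  assumes "Im \<tau> > 0" "a \<noteq> 0"
  shows "q_powr a \<tau> \<noteq> 1"
proof
  assume "q_powr a \<tau> = 1"
  then have "norm (q_powr a \<tau>) = 1" by simp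
  then show False using assms by (simp add: norm_q_powr)
qed

section \<open>Residue classes modulo 1 and series over their positive members\<close>

definition int_class :: "real \<Rightarrow> real set" where
  "int_class x = {m. [m = x] (rmod 1)}"

definition pos_class :: "real \<Rightarrow> real set" where
  "pos_class x = {m. m > 0 \<and> [m = x] (rmod 1)}"

lemma rcong_1_iff: "[a = b] (rmod 1) \<longleftrightarrow> a - b \<in> \<int>"
proof
  assume "[a = b] (rmod 1)"
  then obtain n where "b = a + of_int n" by (auto simp: rcong_altdef)
  then have "a - b = of_int (- n)" by simp
  then show "a - b \<in> \<int>" by (metis Ints_of_int)
next
  assume "a - b \<in> \<int>"
  then obtain n where "a - b = of_int n" by (auto elim: Ints_cases)
  then have "b = a + of_int (- n) * 1" by simp
  then show "[a = b] (rmod 1)" unfolding rcong_altdef by blast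
qed

lemma int_class_cong:
  assumes "x - y \<in> \<int>"
  shows "int_class x = int_class y" "pos_class x = pos_class y"
proof -
  have "[m = x] (rmod 1) \<longleftrightarrow> [m = y] (rmod 1)" for m
    using assms unfolding rcong_1_iff[symmetric] by (meson rcong_sym rcong_trans)
  then show "int_class x = int_class y" "pos_class x = pos_class y"
    by (simp_all add: int_class_def pos_class_def)
qed

lemma int_class_nonzero:
  assumes "x \<notin> \<int>" "m \<in> int_class x"
  shows "m \<noteq> 0"
  using assms by (auto simp: int_class_def rcong_1_iff)

text \<open>For 0 < a <= 1, \<open>a\<close> is the least positive member of its class: a positive
  \<open>m = a + n\<close> has n > -a >= -1. Sums over the class thus become sums over the
  naturals.\<close>

lemma pos_class_image:
  assumes "0 < a" "a \<le> 1"
  shows "pos_class a = range (\<lambda>j::nat. a + real j)"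
proof -
  have "\<exists>j::nat. m = a + real j" if "m > 0" "m - a \<in> \<int>" for m
  proof -
    from that obtain n where n: "m - a = of_int n" by (auto elim: Ints_cases)
    with that assms have "real_of_int n > -1" by linarith
    then have "n \<ge> 0" by linarith
    then have "m = a + real (nat n)" using n by simp
    then show ?thesis by blast
  qed
  then show ?thesis
    using assms by (auto simp: pos_class_def rcong_1_iff)
qed

lemma pos_class_ge:
  assumes "0 < a" "a \<le> 1" "m \<in> pos_class a"
  shows "a \<le> m"
  using assms(3) unfolding pos_class_image[OF assms(1,2)] by auto

text \<open>The value type is general because the lemma serves both complex powers of q and their
  real norms.\<close>

lemma has_sum_geometric_pos_class:
  fixes f :: "real \<Rightarrow> 'a :: {real_normed_field, banach}"
  assumes "0 < a" "a \<le> 1" "norm z < 1" "\<And>j::nat. f (a + real j) = f a * z ^ j"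
  shows "(f has_sum f a / (1 - z)) (pos_class a)"
proof -
  have "((\<lambda>j. f a * z ^ j) has_sum f a * (1 / (1 - z))) UNIV"
    using assms(3) by (intro norm_summable_imp_has_sum sums_mult geometric_sums)
      (simp add: norm_mult norm_power summable_mult summable_geometric)
  then have "((f \<circ> (\<lambda>j::nat. a + real j)) has_sum f a / (1 - z)) UNIV"
    by (simp add: o_def assms(4))
  then show ?thesis
    unfolding pos_class_image[OF assms(1,2)] by (subst has_sum_reindex) (auto simp: inj_on_def)
qed

text \<open>The decay rate \<open>d\<close> is cut into \<open>k + 1\<close> equal parts
  \<open>c\<close>. Since (c t)^k <= exp (k c t), \<open>k\<close> of them absorb the factor
  \<open>t ^ k\<close>, and the last one leaves a geometric series.\<close>

lemma summable_power_exp_pos_class: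
  assumes "0 < a" "a \<le> 1" "d > 0"
  shows "(\<lambda>t. t ^ k * exp (- d * t)) summable_on pos_class a"
proof (rule summable_on_comparison_test)
  define c where "c = d / (real k + 1)"
  have "(real k + 1) * c = d" by (simp add: c_def)
  then have "d = real k * c + c" by (simp only: distrib_right mult_1_left)
  moreover have "c > 0" using assms(3) by (simp add: c_def)
  ultimately have c: "c > 0" "d = real k * c + c" by simp_all
  have "((\<lambda>t. exp (- c * t)) has_sum exp (- c * a) / (1 - exp (- c))) (pos_class a)"
  proof (rule has_sum_geometric_pos_class[OF assms(1,2)])
    show "norm (exp (- c)) < 1" using c(1) by simp
    show "exp (- c * (a + real j)) = exp (- c * a) * exp (- c) ^ j" for j
      by (simp add: algebra_simps flip: exp_add exp_of_nat_mult)
  qed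
  then show "(\<lambda>t. exp (- c * t) / c ^ k) summable_on pos_class a"
    using summable_on_cmult_left[of _ _ "inverse (c ^ k)"] unfolding divide_inverse
    by (auto simp: summable_on_def)
  fix t assume "t \<in> pos_class a"
  then have t: "t > 0" by (simp add: pos_class_def)
  show "0 \<le> t ^ k * exp (- d * t)" using t by simp
  have "c * t \<le> exp (c * t)"
    using exp_ge_add_one_self[of "c * t"] by linarith
  then have "(c * t) ^ k \<le> exp (c * t) ^ k"
    using c t by (intro power_mono) auto
  then have "t ^ k * c ^ k \<le> exp (real k * (c * t))"
    by (simp only: exp_of_nat_mult power_mult_distrib mult.commute)
  then have "t ^ k \<le> exp (real k * (c * t)) / c ^ k"
    using c by (simp add: pos_le_divide_eq)
  then have "t ^ k * exp (- d * t) \<le> exp (real k * (c * t)) / c ^ k * exp (- d * t)"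
    by (intro mult_right_mono) auto
  also have "\<dots> = exp (- c * t) / c ^ k"
    by (simp add: c(2) algebra_simps flip: exp_add)
  finally show "t ^ k * exp (- d * t) \<le> exp (- c * t) / c ^ k" .
qed

section \<open>The geometric kernel \<open>kron\<close> and its partial fractions\<close>

definition kron :: "complex \<Rightarrow> real \<Rightarrow> real \<Rightarrow> complex" where
  "kron \<tau> m u = q_powr (m * u) \<tau> / (1 - q_powr m \<tau>)"

text \<open>Expanding the fraction by q^m flips the sign of the denominator. This carries the
  negative half of a bilateral series to positive indices, with \<open>u\<close> replaced by
  \<open>1 - u\<close>.\<close>

lemma kron_minus:
  assumes "Im \<tau> > 0" "m \<noteq> 0"
  shows "kron \<tau> (- m) u = - kron \<tau> m (1 - u)"
  using q_powr_neq_1[OF assms]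
  by (simp add: kron_def q_powr_minus q_powr_diff right_diff_distrib field_simps)

text \<open>For \<open>u\<close> and \<open>v\<close> in (0, 1), one of \<open>u - v\<close> and
  \<open>v - u\<close> must be shifted by 1 to lie in (0, 1) when they are nonzero. The two
  alternatives say which; the shift supplies the extra factor \<open>B\<close> or \<open>A\<close>
  that the matching partial fraction identity requires.\<close>

lemma kron_mult:
  assumes "Im \<tau> > 0" "m \<noteq> 0" "n \<noteq> 0" "m + n \<noteq> 0"
    and "s = u - v \<and> t = v - u + 1 \<or> s = u - v + 1 \<and> t = v - u"
  shows "kron \<tau> m u * kron \<tau> n v = kron \<tau> (m + n) v * kron \<tau> m s + kron \<tau> (m + n) u * kron \<tau> n t"
proof -
  define A B where "A = q_powr m \<tau>" and "B = q_powr n \<tau>"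
  have AB: "A \<noteq> 1" "B \<noteq> 1" "A * B \<noteq> 1"
    using assms q_powr_neq_1[of \<tau>] by (auto simp: A_def B_def simp flip: q_powr_add)
  \<comment> \<open>Both come from splitting the numerator 1 - A B, as (1 - B) + B (1 - A) and as A
    (1 - B) + (1 - A).\<close>
  have 1: "1 / ((1 - A) * (1 - B)) = 1 / (1 - A * B) * (1 / (1 - A)) + 1 / (1 - A * B) * (B / (1 - B))"
    and 2: "1 / ((1 - A) * (1 - B)) = 1 / (1 - A * B) * (A / (1 - A)) + 1 / (1 - A * B) * (1 / (1 - B))"
    using AB by (simp_all add: divide_simps) (simp_all add: algebra_simps)
  define Q where "Q = q_powr (m * u) \<tau> * q_powr (n * v) \<tau>"
  have L: "kron \<tau> m u * kron \<tau> n v = Q * (1 / ((1 - A) * (1 - B)))"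
    by (simp add: kron_def A_def B_def Q_def)
  have R: "kron \<tau> (m + n) v * kron \<tau> m s =
      (q_powr ((m + n) * v) \<tau> * q_powr (m * s) \<tau>) * (1 / (1 - A * B) * (1 / (1 - A)))"
    "kron \<tau> (m + n) u * kron \<tau> n t =
      (q_powr ((m + n) * u) \<tau> * q_powr (n * t) \<tau>) * (1 / (1 - A * B) * (1 / (1 - B)))"
    by (simp_all add: kron_def A_def B_def q_powr_add[of m n])
  from assms(5) show ?thesis
  proof
    assume "s = u - v \<and> t = v - u + 1"
    then have st: "s = u - v" "t = v - u + 1" by simp_all
    have "q_powr ((m + n) * v) \<tau> * q_powr (m * s) \<tau> = Q"
      and "q_powr ((m + n) * u) \<tau> * q_powr (n * t) \<tau> = Q * B"
      unfolding Q_def B_def q_powr_add[symmetric] st by (simp_all add: algebra_simps)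
    then show ?thesis
      unfolding L R 1 by (simp add: distrib_left)
  next
    assume "s = u - v + 1 \<and> t = v - u"
    then have st: "s = u - v + 1" "t = v - u" by simp_all
    have "q_powr ((m + n) * v) \<tau> * q_powr (m * s) \<tau> = Q * A"
      and "q_powr ((m + n) * u) \<tau> * q_powr (n * t) \<tau> = Q"
      unfolding Q_def A_def q_powr_add[symmetric] st by (simp_all add: algebra_simps)
    then show ?thesis
      unfolding L R 2 by (simp add: distrib_left)
  qed
qed

section \<open>Convergence, and G as a bilateral series of kernels\<close>

lemma kron_abs_summable:
  assumes "Im \<tau> > 0" "0 < x" "x \<le> 1" "0 < u"
  shows "(\<lambda>m. norm (of_real m ^ k * kron \<tau> m u)) summable_on pos_class x"
proof (rule Infinite_Sum.abs_summable_on_comparison_test')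
  define d where "d = 2 * pi * Im \<tau>"
  have d: "d > 0" using assms by (simp add: d_def)
  \<comment> \<open>A bound for 1 / |1 - q^m| uniform on the class: |1 - q^m| >= 1 - |q^m| >= 1 -
    |q^x|, because \<open>x\<close> is the least positive member.\<close>
  define C where "C = inverse (1 - norm (q_powr x \<tau>))"
  have C: "1 - norm (q_powr x \<tau>) > 0" using norm_q_powr_less_1 assms by simp
  show "(\<lambda>m. m ^ k * exp (- (d * u) * m) * C) summable_on pos_class x"
    using d assms by (intro summable_on_cmult_left summable_power_exp_pos_class) auto
  fix m assume m: "m \<in> pos_class x"
  then have "m > 0" "m \<ge> x" using pos_class_ge[OF assms(2,3)] by (auto simp: pos_class_def)
  have "1 - norm (q_powr x \<tau>) \<le> 1 - norm (q_powr m \<tau>)"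
    using norm_q_powr_antimono[OF assms(1) \<open>m \<ge> x\<close>] by simp
  also have "\<dots> \<le> norm (1 - q_powr m \<tau>)"
    using norm_triangle_ineq2[of 1 "q_powr m \<tau>"] by simp
  finally have "inverse (norm (1 - q_powr m \<tau>)) \<le> C"
    unfolding C_def using C by (rule le_imp_inverse_le)
  then have "m ^ k * exp (- (d * u) * m) * inverse (norm (1 - q_powr m \<tau>))
      \<le> m ^ k * exp (- (d * u) * m) * C"
    using \<open>m > 0\<close> by (intro mult_left_mono) auto
  then show "norm (of_real m ^ k * kron \<tau> m u) \<le> m ^ k * exp (- (d * u) * m) * C"
    using \<open>m > 0\<close> by (simp add: kron_def norm_mult norm_divide norm_power norm_q_powr d_def
      norm_inverse divide_inverse algebra_simps)
qed

lemma q_powr_has_sum_pos_class: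
  assumes "Im \<tau> > 0" "m > 0" "0 < u" "u \<le> 1"
  shows "((\<lambda>n. q_powr (m * n) \<tau>) has_sum kron \<tau> m u) (pos_class u)"
    and "((\<lambda>n. norm (q_powr (m * n) \<tau>)) has_sum norm (q_powr (m * u) \<tau>) / (1 - norm (q_powr m \<tau>)))
      (pos_class u)"
proof -
  have 1: "norm (q_powr m \<tau>) < 1"
    using assms by (simp add: norm_q_powr)
  have 2: "q_powr (m * (u + real j)) \<tau> = q_powr (m * u) \<tau> * q_powr m \<tau> ^ j" for j
    by (simp add: distrib_left q_powr_add q_powr_mult_nat)
  show "((\<lambda>n. q_powr (m * n) \<tau>) has_sum kron \<tau> m u) (pos_class u)"
    unfolding kron_def
    by (rule has_sum_geometric_pos_class[OF assms(3,4), of _ "\<lambda>n. q_powr (m * n) \<tau>"]) (use 1 2 in auto)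
  show "((\<lambda>n. norm (q_powr (m * n) \<tau>)) has_sum norm (q_powr (m * u) \<tau>) / (1 - norm (q_powr m \<tau>)))
      (pos_class u)"
    by (rule has_sum_geometric_pos_class[OF assms(3,4), of _ "\<lambda>n. norm (q_powr (m * n) \<tau>)"])
      (use 1 2 in \<open>auto simp: norm_mult norm_power\<close>)
qed

lemma eis_sum_has_sum:
  assumes "Im \<tau> > 0" "0 < x" "x \<le> 1" "0 < u" "u \<le> 1"
  shows "((\<lambda>m. of_real m ^ (k - 1) * kron \<tau> m u) has_sum eis_sum k x u \<tau>) (pos_class x)"
proof -
  define f where "f = (\<lambda>(m, n). of_real m ^ (k - 1) * q_powr (m * n) \<tau>)"
  define d where "d = 2 * pi * Im \<tau>"
  have d: "d > 0" using assms by (simp add: d_def)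
  define C where "C = inverse (1 - norm (q_powr x \<tau>))"
  have C: "1 - norm (q_powr x \<tau>) > 0" using norm_q_powr_less_1 assms by simp
  have "(\<lambda>p. norm (f p)) summable_on pos_class x \<times> pos_class u"
  proof (rule summable_on_SigmaI)
    \<comment> \<open>\<open>g m\<close> is the geometric sum of the norms in row \<open>m\<close>;
      the uniform bound \<open>C\<close> reduces its summability to that of a power times an
      exponential.\<close>
    define g where
      "g m = m ^ (k - 1) * (norm (q_powr (m * u) \<tau>) / (1 - norm (q_powr m \<tau>)))" for m
    show "((\<lambda>n. norm (f (m, n))) has_sum g m) (pos_class u)" if "m \<in> pos_class x" for m
    proof -
      have "m > 0" using that by (simp add: pos_class_def)
      from has_sum_cmult_right[OF q_powr_has_sum_pos_class(2)[OF assms(1) this assms(4,5)]] this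
      show ?thesis by (simp add: f_def g_def norm_mult norm_power)
    qed
    show "g summable_on pos_class x"
    proof (rule summable_on_comparison_test)
      show "(\<lambda>m. m ^ (k - 1) * exp (- (d * u) * m) * C) summable_on pos_class x"
        using d assms by (intro summable_on_cmult_left summable_power_exp_pos_class) auto
      fix m assume m: "m \<in> pos_class x"
      then have "m > 0" "m \<ge> x" using pos_class_ge[OF assms(2,3)] by (auto simp: pos_class_def)
      have ge: "1 - norm (q_powr x \<tau>) \<le> 1 - norm (q_powr m \<tau>)"
        using norm_q_powr_antimono[OF assms(1) \<open>m \<ge> x\<close>] by simp
      then show "0 \<le> g m" using C \<open>m > 0\<close> by (simp add: g_def)
      from ge C have "inverse (1 - norm (q_powr m \<tau>)) \<le> C"
        unfolding C_def by (rule le_imp_inverse_le)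
      then have "m ^ (k - 1) * exp (- (d * u) * m) * inverse (1 - norm (q_powr m \<tau>))
          \<le> m ^ (k - 1) * exp (- (d * u) * m) * C"
        using \<open>m > 0\<close> by (intro mult_left_mono) auto
      then show "g m \<le> m ^ (k - 1) * exp (- (d * u) * m) * C"
        by (simp add: g_def norm_q_powr d_def divide_inverse algebra_simps)
    qed
  qed auto
  \<comment> \<open>From here on the \<open>infsum\<close> inside \<open>eis_sum\<close> is a
    genuine sum and not the default value 0.\<close>
  then have "f summable_on pos_class x \<times> pos_class u"
    by (rule abs_summable_summable)
  then have "(f has_sum infsum f (pos_class x \<times> pos_class u)) (pos_class x \<times> pos_class u)"
    by (rule has_sum_infsum)
  moreover have "pos_class x \<times> pos_class u =
      {(m, n). m > 0 \<and> n > 0 \<and> [m = x] (rmod 1) \<and> [n = u] (rmod 1)}"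
    by (auto simp: pos_class_def)
  ultimately have "(f has_sum eis_sum k x u \<tau>) (pos_class x \<times> pos_class u)"
    by (simp add: eis_sum_def f_def)
  then show ?thesis
  proof (rule has_sum_SigmaD)
    fix m assume "m \<in> pos_class x"
    then have "m > 0" by (simp add: pos_class_def)
    from has_sum_cmult_right[OF q_powr_has_sum_pos_class(1)[OF assms(1) this assms(4,5)]]
    show "((\<lambda>n. f (m, n)) has_sum of_real m ^ (k - 1) * kron \<tau> m u) (pos_class u)"
      by (simp add: f_def)
  qed
qed

text \<open>The class omits 0, so it splits by sign. The positive half gives the first sum of
  \<open>G\<close>. On the negative half, m^(k-1) and \<open>kron_minus\<close> together contribute
  the sign (-1)^k, giving the second sum. The constant term vanishes as neither coordinate is
  integral.\<close>

lemma G_has_sum_unit_interval: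
  assumes "Im \<tau> > 0" "0 < x" "x < 1" "0 < u" "u < 1" "k \<ge> 1"
  shows "((\<lambda>m. of_real m ^ (k - 1) * kron \<tau> m u) has_sum G k x u \<tau>) (int_class x)"
    and "(\<lambda>m. norm (of_real m ^ (k - 1) * kron \<tau> m u)) summable_on int_class x"
proof -
  let ?f = "\<lambda>m. of_real m ^ (k - 1) * kron \<tau> m u"
  \<comment> \<open>The representative \<open>1 - x\<close> of the class of \<open>- x\<close> lies
    in (0, 1), as the series lemmas demand.\<close>
  let ?N = "uminus ` pos_class (1 - x)"
  have nonint: "y \<notin> \<int>" if "0 < y" "y < 1" for y :: real
    using that by (auto elim!: Ints_cases)
  have split: "int_class x = pos_class x \<union> ?N"
  proof -
    have "m \<in> int_class x \<longleftrightarrow> m \<in> pos_class x \<or> m \<in> ?N" for m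
    proof -
      have "m \<in> ?N \<longleftrightarrow> m < 0 \<and> - m - (1 - x) \<in> \<int>"
        unfolding pos_class_def rcong_1_iff image_iff by (auto intro!: exI[of _ "- m"])
      also have "- m - (1 - x) \<in> \<int> \<longleftrightarrow> m - x \<in> \<int>"
      proof -
        have "- m - (1 - x) = - ((m - x) + 1)" by simp
        also have "\<dots> \<in> \<int> \<longleftrightarrow> m - x \<in> \<int>"
          unfolding minus_in_Ints_iff by (metis Ints_1 Ints_add Ints_diff add_diff_cancel_right')
        finally show ?thesis .
      qed
      finally show ?thesis
        using int_class_nonzero[OF nonint[OF assms(2,3)], of m]
        by (auto simp: int_class_def pos_class_def rcong_1_iff)
    qed
    then show ?thesis by blast
  qed
  have disj: "pos_class x \<inter> ?N = {}"
    by (auto simp: pos_class_def)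
  have reflect: "(?f \<circ> uminus) m = (- 1) ^ k * (of_real m ^ (k - 1) * kron \<tau> m (1 - u))"
    if "m \<in> pos_class (1 - x)" for m
  proof -
    have "m \<noteq> 0" using that by (simp add: pos_class_def)
    \<comment> \<open>Positivity of \<open>k\<close> matters: the sign (-1)^(k-1) times -1 is (-1)^k
      only if \<open>k - 1\<close> is not truncated.\<close>
    moreover obtain j where "k = Suc j" using assms(6) by (cases k) auto
    ultimately show ?thesis
      by (simp add: kron_minus[OF assms(1)] power_minus[of "of_real m"])
  qed
  have "eis_sum k (1 - x) (1 - u) \<tau> = eis_sum k (- x) (- u) \<tau>"
  proof -
    have "pos_class (1 - x) = pos_class (- x)" "pos_class (1 - u) = pos_class (- u)"
      by (rule int_class_cong; simp)+
    moreover have "{(m, n). m > 0 \<and> n > 0 \<and> [m = a] (rmod 1) \<and> [n = b] (rmod 1)}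
        = pos_class a \<times> pos_class b" for a b
      by (auto simp: pos_class_def)
    ultimately show ?thesis by (simp add: eis_sum_def)
  qed
  moreover have "((\<lambda>m. of_real m ^ (k - 1) * kron \<tau> m (1 - u)) has_sum eis_sum k (1 - x) (1 - u) \<tau>)
      (pos_class (1 - x))"
    using assms by (intro eis_sum_has_sum) auto
  ultimately have "((\<lambda>m. of_real m ^ (k - 1) * kron \<tau> m (1 - u)) has_sum eis_sum k (- x) (- u) \<tau>)
      (pos_class (1 - x))"
    by simp
  from has_sum_cmult_right[OF this, of "(- 1) ^ k"]
  have "((?f \<circ> uminus) has_sum (- 1) ^ k * eis_sum k (- x) (- u) \<tau>) (pos_class (1 - x))"
    using has_sum_cong[of "pos_class (1 - x)" "?f \<circ> uminus", OF reflect] by blast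
  then have neg: "(?f has_sum (- 1) ^ k * eis_sum k (- x) (- u) \<tau>) ?N"
    by (subst has_sum_reindex) auto
  have "a0 k x u = 0"
    using nonint[OF assms(2,3)] nonint[OF assms(4,5)] by (simp add: a0_def)
  then have "G k x u \<tau> = eis_sum k x u \<tau> + (- 1) ^ k * eis_sum k (- x) (- u) \<tau>"
    by (simp add: G_def)
  then show "(?f has_sum G k x u \<tau>) (int_class x)"
    unfolding split using has_sum_Un_disjoint[OF eis_sum_has_sum neg disj] assms by simp
  have "(\<lambda>m. norm ((?f \<circ> uminus) m)) summable_on pos_class (1 - x)"
  proof -
    have "(\<lambda>m. norm (of_real m ^ (k - 1) * kron \<tau> m (1 - u))) summable_on pos_class (1 - x)"
      using assms by (intro kron_abs_summable) auto
    then show ?thesis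
      by (rule summable_on_cong[THEN iffD2, rotated])
        (simp only: reflect, simp add: norm_mult norm_power)
  qed
  then have "(\<lambda>m. norm (?f m)) summable_on ?N"
    by (subst summable_on_reindex) (auto simp: o_def)
  then show "(\<lambda>m. norm (?f m)) summable_on int_class x"
    unfolding split using assms disj by (intro summable_on_Un_disjoint kron_abs_summable) auto
qed

text \<open>The series and \<open>G\<close> depend on \<open>x\<close> only through its class, so
  \<open>frac x\<close> may replace it. The range of \<open>u\<close> remains restricted: shifting
  \<open>u\<close> by an integer changes each term by a power of q^m.\<close>

lemma G_has_sum:
  assumes "Im \<tau> > 0" "x \<notin> \<int>" "0 < u" "u < 1" "k \<ge> 1"
  shows "((\<lambda>m. of_real m ^ (k - 1) * kron \<tau> m u) has_sum G k x u \<tau>) (int_class x)"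
    and "(\<lambda>m. norm (of_real m ^ (k - 1) * kron \<tau> m u)) summable_on int_class x"
proof -
  have x: "x - frac x \<in> \<int>" by (simp add: frac_def)
  have "0 < frac x" "frac x < 1" using assms(2) by (simp_all add: frac_gt_0_iff frac_lt_1)
  from G_has_sum_unit_interval[OF assms(1) this assms(3-5)]
  show "((\<lambda>m. of_real m ^ (k - 1) * kron \<tau> m u) has_sum G k x u \<tau>) (int_class x)"
    and "(\<lambda>m. norm (of_real m ^ (k - 1) * kron \<tau> m u)) summable_on int_class x"
    using int_class_cong(1)[OF x] G_cong[OF x, of u u] by simp_all
qed

section \<open>The change of variables l = m + n and the product identity\<close>

lemma int_class_add: "m \<in> int_class x \<Longrightarrow> n \<in> int_class y \<Longrightarrow> m + n \<in> int_class (x + y)"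
  unfolding int_class_def by (simp add: rcong_add)

lemma int_class_diff: "m \<in> int_class x \<Longrightarrow> n \<in> int_class y \<Longrightarrow> m - n \<in> int_class (x - y)"
  unfolding int_class_def by (simp add: rcong_diff)

text \<open>With l = m + n, either summand together with l determines the pair, by subtraction. This
  moves the three products involving \<open>x + y\<close> onto the index set of the remaining
  one.\<close>

lemma bij_betw_int_class_add:
  shows "bij_betw (\<lambda>(m, n). (m + n, m)) (int_class x \<times> int_class y) (int_class (x + y) \<times> int_class x)"
    and "bij_betw (\<lambda>(m, n). (m + n, n)) (int_class x \<times> int_class y) (int_class (x + y) \<times> int_class y)"
proof -
  have "l - m \<in> int_class y" if "l \<in> int_class (x + y)" "m \<in> int_class x" for l m
    using int_class_diff[OF that] by simp
  then show "bij_betw (\<lambda>(m, n). (m + n, m)) (int_class x \<times> int_class y) (int_class (x + y) \<times> int_class x)"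
    by (intro bij_betw_byWitness[where f' = "\<lambda>(l, m). (m, l - m)"]) (auto intro: int_class_add)
  have "l - n \<in> int_class x" if "l \<in> int_class (x + y)" "n \<in> int_class y" for l n
    using int_class_diff[OF that] by simp
  then show "bij_betw (\<lambda>(m, n). (m + n, n)) (int_class x \<times> int_class y) (int_class (x + y) \<times> int_class y)"
    by (intro bij_betw_byWitness[where f' = "\<lambda>(l, n). (l - n, n)"]) (auto intro: int_class_add)
qed

text \<open>The final identity for representatives in (0, 1), solved for the product indexed by
  \<open>(m, n)\<close> itself. The three products on the right carry the weights m, l and n;
  \<open>st\<close> is the case distinction of \<open>kron_mult\<close>.\<close>

lemma G_mult:
  assumes "Im \<tau> > 0" "x \<notin> \<int>" "y \<notin> \<int>" "x + y \<notin> \<int>"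
    and u: "0 < u" "u < 1" and v: "0 < v" "v < 1" and s: "0 < s" "s < 1" and t: "0 < t" "t < 1"
    and st: "s = u - v \<and> t = v - u + 1 \<or> s = u - v + 1 \<and> t = v - u"
  shows "G 2 x u \<tau> * G 1 y v \<tau> =
    G 1 (x + y) v \<tau> * G 2 x s \<tau> + (G 2 (x + y) u \<tau> * G 1 y t \<tau> - G 1 (x + y) u \<tau> * G 2 y t \<tau>)"
    (is "?L = ?R")
proof -
  let ?S = "int_class x \<times> int_class y"
  let ?k = "kron \<tau>"
  have G1: "((\<lambda>m. ?k m w) has_sum G 1 z w \<tau>) (int_class z)" "(\<lambda>m. norm (?k m w)) summable_on int_class z"
    if "z \<notin> \<int>" "0 < w" "w < 1" for z w
    using G_has_sum[OF assms(1) that, of 1] by simp_all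
  have G2: "((\<lambda>m. of_real m * ?k m w) has_sum G 2 z w \<tau>) (int_class z)"
    "(\<lambda>m. norm (of_real m * ?k m w)) summable_on int_class z"
    if "z \<notin> \<int>" "0 < w" "w < 1" for z w
    using G_has_sum[OF assms(1) that, of 2] by simp_all
  note bij = has_sum_reindex_bij_betw[OF bij_betw_int_class_add(1)[of x y], THEN iffD2]
    has_sum_reindex_bij_betw[OF bij_betw_int_class_add(2)[of x y], THEN iffD2]
  have L: "((\<lambda>(m, n). (of_real m * ?k m u) * ?k n v) has_sum ?L) ?S"
    using assms by (intro has_sum_mult_Times G1 G2) auto
  have "((\<lambda>(l, m). ?k l v * (of_real m * ?k m s)) has_sum G 1 (x + y) v \<tau> * G 2 x s \<tau>)
      (int_class (x + y) \<times> int_class x)"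
    using assms by (intro has_sum_mult_Times G1 G2) auto
  note R1 = bij(1)[OF this]
  have "((\<lambda>(l, n). (of_real l * ?k l u) * ?k n t) has_sum G 2 (x + y) u \<tau> * G 1 y t \<tau>)
      (int_class (x + y) \<times> int_class y)"
    using assms by (intro has_sum_mult_Times G1 G2) auto
  note R2 = bij(2)[OF this]
  have "((\<lambda>(l, n). ?k l u * (of_real n * ?k n t)) has_sum G 1 (x + y) u \<tau> * G 2 y t \<tau>)
      (int_class (x + y) \<times> int_class y)"
    using assms by (intro has_sum_mult_Times G1 G2) auto
  note R3 = bij(2)[OF this]
  \<comment> \<open>The re-indexed series are combined termwise, the difference being read as
    addition of a negative; the resulting summand is m times the right side of
    \<open>kron_mult\<close>.\<close>
  have "((\<lambda>(m, n). (of_real m * ?k m u) * ?k n v) has_sum ?R) ?S"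
  proof (unfold diff_conv_add_uminus, rule has_sum_cong[THEN iffD1, OF _ has_sum_add[OF R1 has_sum_add[OF R2 has_sum_uminusI[OF R3]]]], clarsimp)
    fix m n assume m: "m \<in> int_class x" and n: "n \<in> int_class y"
    then have "m + n \<in> int_class (x + y)" by (rule int_class_add)
    then have "m \<noteq> 0" "n \<noteq> 0" "m + n \<noteq> 0"
      using int_class_nonzero assms(2-4) m n by blast+
    note kron_mult[OF assms(1) this st]
    then have "of_real m * (?k m u * ?k n v)
        = of_real m * (?k (m + n) v * ?k m s + ?k (m + n) u * ?k n t)" by simp
    then show "?k (m + n) v * (of_real m * ?k m s) + ((of_real m + of_real n) * ?k (m + n) u * ?k n t
        - ?k (m + n) u * (of_real n * ?k n t)) = of_real m * ?k m u * ?k n v"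
      by (simp add: algebra_simps)
  qed
  with L show ?thesis by (rule has_sum_unique)
qed

theorem theorem6p3:
  fixes x1 y1 u2 v2 :: real and \<tau> :: complex
  assumes "x1 \<notin> \<int>" and "y1 \<notin> \<int>" and "u2 \<notin> \<int>" and "v2 \<notin> \<int>"
    and "x1 + y1 \<notin> \<int>" and "u2 - v2 \<notin> \<int>"
    and "Im \<tau> > 0"
  shows "G 1 (x1 + y1) u2 \<tau> * G 2 y1 (v2 - u2) \<tau>
       + G 1 y1 v2 \<tau> * G 2 x1 u2 \<tau>
       - G 1 (x1 + y1) v2 \<tau> * G 2 x1 (u2 - v2) \<tau>
       - G 1 y1 (v2 - u2) \<tau> * G 2 (x1 + y1) u2 \<tau> = 0"
proof -
  \<comment> \<open>The kernel series require second coordinates in (0, 1), so these are replaced by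
    their fractional parts.\<close>
  have Gfrac: "G k x w = G k x (frac w)" for k x w
    by (rule G_cong) (simp_all add: frac_def)
  have range: "0 < frac w" "frac w < 1" if "w \<notin> \<int>" for w :: real
    using that by (simp_all add: frac_gt_0_iff frac_lt_1)
  have "v2 - u2 \<notin> \<int>"
    using assms(6) by (metis Ints_minus minus_diff_eq)
  note range = range[OF assms(3)] range[OF assms(4)] range[OF assms(6)] range[OF this]
  have t: "frac (v2 - u2) = 1 - frac (u2 - v2)"
    using frac_neg[of "u2 - v2"] assms(6) by simp
  obtain j :: int where j: "frac (u2 - v2) = frac u2 - frac v2 + of_int j"
  proof
    show "frac (u2 - v2) = frac u2 - frac v2 + of_int (\<lfloor>u2\<rfloor> - \<lfloor>v2\<rfloor> - \<lfloor>u2 - v2\<rfloor>)"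
      by (simp add: frac_def)
  qed
  \<comment> \<open>\<open>j\<close> is the difference of a number in (0, 1) and one in (-1, 1). The
    values 0 and 1 of \<open>j\<close> yield the two alternatives of \<open>G_mult\<close>.\<close>
  with range have "real_of_int j > -1" "real_of_int j < 2" by linarith+
  then have "j = 0 \<or> j = 1" by linarith
  then have "frac (u2 - v2) = frac u2 - frac v2 \<and> frac (v2 - u2) = frac v2 - frac u2 + 1 \<or>
      frac (u2 - v2) = frac u2 - frac v2 + 1 \<and> frac (v2 - u2) = frac v2 - frac u2"
    using j t by auto
  from G_mult[OF assms(7,1,2,5) range this]
  show ?thesis
    unfolding Gfrac[of _ _ u2] Gfrac[of _ _ v2] Gfrac[of _ _ "u2 - v2"] Gfrac[of _ _ "v2 - u2"]
    by (simp add: algebra_simps)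
qed

end
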